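(* Let $\Pi_\mu$ be a probability measure on $C[0,1]$ with full sup-norm support, i.e. $\Pi_\mu(\|\mu-\mu^*\|_\infty<\epsilon)>0$ for every $\epsilon>0$ and every $\mu^*\in C[0,1]$, and let $\Pi_\sigma$ be a probability measure on $[0,\infty)$ with full support, i.e. assigning positive mass to every nonempty open subset of $[0,\infty)$. Let $\Pi$ be the prior on densities on $\mathbb{R}$ induced by $\Pi_\mu\otimes\Pi_\sigma$ through the map $(\mu,\sigma)\mapsto f_{\mu,\sigma}$. Then the $L_1$ support of $\Pi$ contains every density $f_0$ on $\mathbb{R}$ that has a finite first moment ($\int|x|f_0(x)\,dx<\infty$) and is non-zero almost everywhere on its support; that is, for every such $f_0$ and every $\epsilon>0$, $$\Pi\big(f:\ \|f-f_0\|_1<\epsilon\big)=(\Pi_\mu\otimes\Pi_\sigma)\big(\{(\mu,\sigma):\sigma>0,\ \|f_{\mu,\sigma}-f_0\|_1<\epsilon\}\big)>0.$$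
   Context: For $\mu\in C[0,1]$ and $\sigma>0$, $f_{\mu,\sigma}(y)=\int_0^1\phi_\sigma(y-\mu(x))\,dx$, where $\phi_\sigma(x)=\sigma^{-1}\phi(x/\sigma)$ and $\phi$ is the standard normal density. Densities are with respect to Lebesgue measure on $\mathbb{R}$ and $\|\cdot\|_1$ is the $L_1$ norm with respect to Lebesgue measure. *)

theory Defs
  imports "HOL-Probability.Probability"
begin

(* C[0,1] with the sup metric. The library's function space consists of functions that are
   undefined outside the domain, so every continuous function on [0,1] has one representative. *)
definition C01 :: "(real \<Rightarrow> real) metric" where
  "C01 = cfunspace (top_of_set {0..1}) euclidean_metric"

lemma mspace_C01: "mspace C01 = {f. continuous_on {0..1} f \<and> f \<in> extensional {0..1}}"
proof -
  have "Met_TC.mbounded (f ` {0..1})" if "continuous_on {0..1} f" for f :: "real \<Rightarrow> real"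
    using compact_continuous_image[OF that] by (simp add: compact_imp_bounded)
  then show ?thesis
    unfolding C01_def by auto
qed

lemma mdist_C01:
  assumes "f \<in> mspace C01" "g \<in> mspace C01"
  shows "mdist C01 f g = (SUP x\<in>{0..1}. \<bar>f x - g x\<bar>)"
  using assms
  by (simp add: C01_def mdist_cfunspace_eq_mdist_funspace Met_TC.fdist_def Met_TC.fspace_def dist_real_def)

definition borel_C01 :: "(real \<Rightarrow> real) measure" where
  "borel_C01 = sigma (mspace C01) {U. openin (mtopology_of C01) U}"

definition phi_scaled :: "real \<Rightarrow> real \<Rightarrow> real" where
  "phi_scaled \<sigma> x = inverse \<sigma> * std_normal_density (x / \<sigma>)"

definition f_mix :: "(real \<Rightarrow> real) \<Rightarrow> real \<Rightarrow> real \<Rightarrow> real" where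
  "f_mix \<mu> \<sigma> y = (LINT x:{0..1}|lborel. phi_scaled \<sigma> (y - \<mu> x))"

(* A Bochner integral equal to 1 forces integrability. *)
definition densities :: "(real \<Rightarrow> real) set" where
  "densities = {f \<in> borel_measurable borel. (\<forall>x. 0 \<le> f x) \<and> (LINT x|lborel. f x) = 1}"

definition L1_norm :: "(real \<Rightarrow> real) \<Rightarrow> real" where
  "L1_norm h = (LINT x|lborel. \<bar>h x\<bar>)"

definition L1_ball :: "(real \<Rightarrow> real) \<Rightarrow> real \<Rightarrow> (real \<Rightarrow> real) set" where
  "L1_ball f0 \<epsilon> = {f \<in> densities. L1_norm (\<lambda>x. f x - f0 x) < \<epsilon>}"

(* The Borel sigma-algebra of the L1 pseudometric on densities. Functions are not identified
   when they agree almost everywhere, but every L1-open set is closed under such changes. *)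
definition density_space :: "(real \<Rightarrow> real) measure" where
  "density_space = sigma densities
     {U. U \<subseteq> densities \<and> (\<forall>f\<in>U. \<exists>\<epsilon>>0. L1_ball f \<epsilon> \<subseteq> U)}"

(* f_mix is a density only for \<sigma> > 0, so the product measure is restricted there before
   it is pushed forward. A possible atom of the prior on \<sigma> at 0 contributes no mass. *)
definition induced_prior :: "(real \<Rightarrow> real) measure \<Rightarrow> real measure \<Rightarrow> (real \<Rightarrow> real) measure" where
  "induced_prior \<Pi>\<mu> \<Pi>\<sigma> =
     distr (restrict_space (\<Pi>\<mu> \<Otimes>\<^sub>M \<Pi>\<sigma>) {(\<mu>, \<sigma>). 0 < \<sigma>}) density_space
       (\<lambda>(\<mu>, \<sigma>). f_mix \<mu> \<sigma>)"

definition L1_support :: "(real \<Rightarrow> real) measure \<Rightarrow> (real \<Rightarrow> real) set" where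
  "L1_support P = {f \<in> densities. \<forall>\<epsilon>>0. 0 < emeasure P (L1_ball f \<epsilon>)}"

(* The support of the distribution with density f. Unlike closure {x. f x \<noteq> 0} it does not
   depend on the choice of f within its almost-everywhere class. *)
definition density_support :: "(real \<Rightarrow> real) \<Rightarrow> real set" where
  "density_support f = {x. \<forall>U. open U \<and> x \<in> U \<longrightarrow> 0 < (LINT y:U|lborel. f y)}"

(* Hence a density that is non-zero almost everywhere on closure {x. f x \<noteq> 0} is also
   non-zero almost everywhere on density_support f. *)
lemma density_support_subset: "density_support f \<subseteq> closure {x. f x \<noteq> 0}"
proof
  fix x assume x: "x \<in> density_support f"
  show "x \<in> closure {x. f x \<noteq> 0}"
  proof (rule ccontr)
    assume "x \<notin> closure {x. f x \<noteq> 0}"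
    then have "x \<in> - closure {x. f x \<noteq> 0}" by simp
    moreover have "open (- closure {x. f x \<noteq> 0})" by (simp add: open_Compl)
    ultimately have "0 < (LINT y:- closure {x. f x \<noteq> 0}|lborel. f y)"
      using x unfolding density_support_def by blast
    moreover have "(\<lambda>y. indicator (- closure {x. f x \<noteq> 0}) y *\<^sub>R f y) = (\<lambda>y. 0)"
      using closure_subset[of "{x. f x \<noteq> 0}"] by (intro ext) (auto simp: indicator_def)
    ultimately show False
      unfolding set_lebesgue_integral_def by (simp only: Bochner_Integration.integral_zero less_irrefl)
  qed
qed

end

theory Submission
  imports Defs
begin

text \<open>
  The mixture map \<open>(\<mu>, \<sigma>) \<mapsto> f_mix \<mu> \<sigma>\<close> is continuous from \<open>C[0,1] \<times> (0, \<infinity>)\<close> to \<open>L1\<close>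
  (\<open>f_mix_continuous_C01\<close>), and its image is dense among the densities
  (\<open>f_mix_approximates_density\<close>). Some mixture with continuous \<open>\<mu>\<close> is thus closer than
  \<open>\<epsilon> / 2\<close> to \<open>f0\<close>, and all mixtures whose parameters lie in a small enough product neighbourhood of
  \<open>(\<mu>, \<sigma>)\<close> are closer than \<open>\<epsilon>\<close>. Full support of both priors gives that neighbourhood positive
  product measure.

  Density of the image rests on the quantile function. If \<open>q\<close> is the quantile function of a density
  \<open>h\<close>, then \<open>f_mix q \<sigma>\<close> is the convolution of \<open>h\<close> with a centred Gaussian of standard deviation
  \<open>\<sigma>\<close> (\<open>f_mix_quantile\<close>), which for bounded continuous \<open>h\<close> converges to \<open>h\<close> as \<open>\<sigma>\<close> tends to \<open>0\<close>
  (\<open>gaussian_smoothing_tendsto\<close>). Bounded continuous densities approximate \<open>f0\<close> in \<open>L1\<close>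
  (\<open>density_approx_continuous_density\<close>). The function \<open>q\<close> may be discontinuous and unbounded, but it is
  an almost everywhere limit of continuous functions, and for fixed \<open>\<sigma>\<close> the mixture depends continuously
  on the mixing function even for almost everywhere convergence (\<open>f_mix_tendsto_L1\<close>).

  All limits in \<open>L1\<close> are limits of densities and follow from pointwise limits by Scheffe's theorem.

  The equality of the induced prior of a ball with the product measure of its preimage requires the
  mixture map to be measurable for the product sigma-algebra. That is a consequence of its continuity
  (\<open>open_C01_times_pos_sets\<close>).
\<close>

section \<open>Densities and the L1 distance\<close>

lemma densities_integrable: "f \<in> densities \<Longrightarrow> integrable lborel f"
  unfolding densities_def using not_integrable_integral_eq by fastforce

lemma L1_norm_triangle:
  assumes "f \<in> densities" "g \<in> densities" "h \<in> densities"
  shows "L1_norm (\<lambda>x. f x - h x) \<le> L1_norm (\<lambda>x. f x - g x) + L1_norm (\<lambda>x. g x - h x)"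
proof -
  note [simp] = densities_integrable[OF assms(1)] densities_integrable[OF assms(2)]
    densities_integrable[OF assms(3)]
  have "L1_norm (\<lambda>x. f x - h x) \<le> (LINT x|lborel. \<bar>f x - g x\<bar> + \<bar>g x - h x\<bar>)"
    unfolding L1_norm_def by (intro integral_mono) auto
  then show ?thesis
    unfolding L1_norm_def by (subst (asm) Bochner_Integration.integral_add) auto
qed

lemma densities_nn_integral:
  assumes "f \<in> densities"
  shows "(\<integral>\<^sup>+x. ennreal (norm (f x)) \<partial>lborel) = 1"
proof -
  have "(\<integral>\<^sup>+x. ennreal (norm (f x)) \<partial>lborel) = (\<integral>\<^sup>+x. ennreal (f x) \<partial>lborel)"
    using assms by (simp add: densities_def)
  also have "\<dots> = ennreal (LINT x|lborel. f x)"
    using densities_integrable[OF assms] assms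
    by (intro nn_integral_eq_integral) (auto simp: densities_def)
  finally show ?thesis using assms by (simp add: densities_def)
qed

text \<open>
  This is Scheffe's theorem. Every \<open>L1\<close> limit of densities below is obtained from it, so that only
  pointwise convergence ever has to be established.
\<close>

lemma densities_tendsto_L1:
  assumes "\<And>n. F n \<in> densities" "f \<in> densities"
    and "AE x in lborel. (\<lambda>n. F n x) \<longlonglongrightarrow> f x"
  shows "(\<lambda>n. L1_norm (\<lambda>x. F n x - f x)) \<longlonglongrightarrow> 0"
proof -
  have meas: "F n \<in> borel_measurable lborel" for n using assms(1)[of n] by (simp add: densities_def)
  note int = densities_integrable[OF assms(1)] densities_integrable[OF assms(2)]
  have "(\<lambda>n. \<integral>\<^sup>+x. norm (F n x - f x) \<partial>lborel) \<longlonglongrightarrow> 0"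
    using densities_nn_integral assms(1,2)
    by (intro Scheffe_lemma2 meas int assms(3)) simp
  moreover have "(\<integral>\<^sup>+x. norm (F n x - f x) \<partial>lborel) = ennreal (L1_norm (\<lambda>x. F n x - f x))" for n
    unfolding L1_norm_def real_norm_def using int by (intro nn_integral_eq_integral) auto
  ultimately have "(\<lambda>n. ennreal (L1_norm (\<lambda>x. F n x - f x))) \<longlonglongrightarrow> ennreal 0" by simp
  then show ?thesis
    by (subst (asm) tendsto_ennreal_iff) (auto simp: L1_norm_def)
qed

section \<open>Gaussian location mixtures\<close>

text \<open>
  The mixing measure as a probability space of its own, so that a mixture is an expectation over it.
\<close>

abbreviation unit_lebesgue :: "real measure" where
  "unit_lebesgue \<equiv> restrict_space lborel {0..1}"

interpretation unit_lebesgue: prob_space unit_lebesgue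
  by (rule prob_spaceI) (simp add: emeasure_restrict_space space_restrict_space)

lemma phi_scaled_eq_normal_density: "0 < \<sigma> \<Longrightarrow> phi_scaled \<sigma> (y - m) = normal_density m \<sigma> y"
  unfolding phi_scaled_def normal_density_def
  by (simp add: real_sqrt_mult power_divide field_simps)

lemma f_mix_eq: "0 < \<sigma> \<Longrightarrow> f_mix \<mu> \<sigma> y = (LINT x|unit_lebesgue. normal_density (\<mu> x) \<sigma> y)"
  by (simp add: f_mix_def set_lebesgue_integral_def integral_restrict_space phi_scaled_eq_normal_density)

lemma normal_density_le: "normal_density m \<sigma> y \<le> 1 / sqrt (2 * pi * \<sigma>\<^sup>2)"
  unfolding normal_density_def by (simp add: divide_right_mono)

lemma measurable_normal_density_location [measurable]:
  assumes [measurable]: "m \<in> borel_measurable M" "y \<in> borel_measurable M"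
  shows "(\<lambda>x. normal_density (m x) \<sigma> (y x)) \<in> borel_measurable M"
  unfolding normal_density_def by measurable

lemma continuous_on_unit_measurable:
  "continuous_on {0..1} \<mu> \<Longrightarrow> \<mu> \<in> borel_measurable unit_lebesgue"
  using borel_measurable_continuous_on_restrict
  by (subst measurable_cong_sets[OF sets_restrict_space_cong[OF sets_lborel] refl])

text \<open>
  The total mass is computed by exchanging the order of integration. Mixing functions are taken to be
  measurable only, so that quantile functions are covered.
\<close>

lemma f_mix_in_densities:
  assumes [measurable]: "\<mu> \<in> borel_measurable unit_lebesgue" and "0 < \<sigma>"
  shows "f_mix \<mu> \<sigma> \<in> densities"
proof -
  interpret pair_sigma_finite unit_lebesgue lborel ..
  have [measurable]: "(\<lambda>(x, y). normal_density (\<mu> x) \<sigma> y) \<in> borel_measurable (unit_lebesgue \<Otimes>\<^sub>M lborel)"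
    by measurable
  have int: "integrable unit_lebesgue (\<lambda>x. normal_density (\<mu> x) \<sigma> y)" for y
    by (rule unit_lebesgue.integrable_const_bound[of _ "1 / sqrt (2 * pi * \<sigma>\<^sup>2)"])
      (use normal_density_le in auto)
  have eq: "f_mix \<mu> \<sigma> = (\<lambda>y. LINT x|unit_lebesgue. normal_density (\<mu> x) \<sigma> y)"
    using f_mix_eq[OF assms(2)] by blast
  have meas: "f_mix \<mu> \<sigma> \<in> borel_measurable borel"
    unfolding eq by measurable
  have "(\<integral>\<^sup>+y. ennreal (f_mix \<mu> \<sigma> y) \<partial>lborel)
      = (\<integral>\<^sup>+y. \<integral>\<^sup>+x. ennreal (normal_density (\<mu> x) \<sigma> y) \<partial>unit_lebesgue \<partial>lborel)"
    unfolding eq using int by (subst nn_integral_eq_integral) auto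
  also have "\<dots> = (\<integral>\<^sup>+x. \<integral>\<^sup>+y. ennreal (normal_density (\<mu> x) \<sigma> y) \<partial>lborel \<partial>unit_lebesgue)"
    by (rule Fubini') measurable
  also have "\<dots> = (\<integral>\<^sup>+x. 1 \<partial>unit_lebesgue)"
    using assms(2) by (subst nn_integral_eq_integral) auto
  also have "\<dots> = 1" using unit_lebesgue.emeasure_space_1 by simp
  finally have 1: "(\<integral>\<^sup>+y. ennreal (f_mix \<mu> \<sigma> y) \<partial>lborel) = 1" .
  have nn: "0 \<le> f_mix \<mu> \<sigma> y" for y unfolding eq by simp
  then have "(LINT y|lborel. f_mix \<mu> \<sigma> y) = 1"
    using meas 1 by (subst integral_eq_nn_integral) auto
  then show ?thesis using meas nn by (simp add: densities_def)
qed

text \<open>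
  At each fixed point the Gaussian kernels converge boundedly, because \<open>\<sigma>s\<close> stays away from \<open>0\<close>;
  hence the mixtures converge pointwise, which suffices for densities. The lemma serves
  two purposes: with uniform convergence it gives continuity of the mixture map on \<open>C[0,1]\<close>, and
  with almost everywhere convergence it replaces a quantile function by a continuous one.
\<close>

lemma f_mix_tendsto_L1:
  assumes meas: "\<And>n. \<mu>s n \<in> borel_measurable unit_lebesgue" "\<mu> \<in> borel_measurable unit_lebesgue"
    and lim: "AE x in unit_lebesgue. (\<lambda>n. \<mu>s n x) \<longlonglongrightarrow> \<mu> x"
    and s: "\<And>n. 0 < \<sigma>s n" "0 < \<sigma>" "\<sigma>s \<longlonglongrightarrow> \<sigma>"
  shows "(\<lambda>n. L1_norm (\<lambda>y. f_mix (\<mu>s n) (\<sigma>s n) y - f_mix \<mu> \<sigma> y)) \<longlonglongrightarrow> 0"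
proof (rule densities_tendsto_L1)
  note [measurable] = meas
  have "(\<lambda>n. 1 / sqrt (2 * pi * (\<sigma>s n)\<^sup>2)) \<longlonglongrightarrow> 1 / sqrt (2 * pi * \<sigma>\<^sup>2)"
    using s by (intro tendsto_intros) auto
  then have "Bseq (\<lambda>n. 1 / sqrt (2 * pi * (\<sigma>s n)\<^sup>2))"
    using convergent_imp_Bseq convergentI by blast
  then obtain K where K: "\<And>n. norm (1 / sqrt (2 * pi * (\<sigma>s n)\<^sup>2)) \<le> K" by (auto simp: Bseq_def)
  have bound: "norm (normal_density m (\<sigma>s n) y) \<le> K" for m n y
    using K[of n] normal_density_le[of m "\<sigma>s n" y] by (smt (verit) normal_density_nonneg real_norm_def)
  have "(\<lambda>n. f_mix (\<mu>s n) (\<sigma>s n) y) \<longlonglongrightarrow> f_mix \<mu> \<sigma> y" for y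
    unfolding f_mix_eq[OF s(1)] f_mix_eq[OF s(2)]
  proof (rule integral_dominated_convergence)
    show "AE x in unit_lebesgue. (\<lambda>n. normal_density (\<mu>s n x) (\<sigma>s n) y) \<longlonglongrightarrow> normal_density (\<mu> x) \<sigma> y"
      using lim
    proof eventually_elim
      case (elim x)
      then show ?case
        unfolding normal_density_def using s by (intro tendsto_intros) auto
    qed
    show "integrable unit_lebesgue (\<lambda>x. K)" by simp
    show "AE x in unit_lebesgue. norm (normal_density (\<mu>s n x) (\<sigma>s n) y) \<le> K" for n
      using bound by simp
  qed measurable
  then show "AE y in lborel. (\<lambda>n. f_mix (\<mu>s n) (\<sigma>s n) y) \<longlonglongrightarrow> f_mix \<mu> \<sigma> y" by simp
qed (use assms f_mix_in_densities in auto)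

section \<open>Approximation by continuous functions and densities\<close>

lemma AE_limit_of_continuous:
  fixes f :: "real \<Rightarrow> real"
  assumes "f \<in> borel_measurable borel"
  obtains g where "\<And>n::nat. continuous_on UNIV (g n)" "AE x in lborel. (\<lambda>n. g n x) \<longlonglongrightarrow> f x"
proof -
  have "f \<in> borel_measurable lebesgue" using assms by (intro measurable_completion) simp
  then have "f measurable_on UNIV" by (intro lebesgue_measurable_imp_measurable_on) auto
  then obtain N g where N: "negligible N" and g: "\<And>n. continuous_on UNIV (g n)"
    and lim: "\<And>x. x \<notin> N \<Longrightarrow> (\<lambda>n. g n x) \<longlonglongrightarrow> f x"
    unfolding measurable_on_def by auto
  obtain N' where N': "N' \<in> null_sets lborel" "N \<subseteq> N'"
    using N unfolding negligible_iff_null_sets null_sets_completion_iff2 by blast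
  have "{x \<in> space lborel. \<not> (\<lambda>n. g n x) \<longlonglongrightarrow> f x} \<subseteq> N'"
    using lim N'(2) by blast
  then have "AE x in lborel. (\<lambda>n. g n x) \<longlonglongrightarrow> f x"
    by (rule AE_I'[OF N'(1)])
  then show ?thesis by (rule that[OF g])
qed

text \<open>
  Almost everywhere limits of continuous functions are not dominated, so the approximation is applied
  to the ratio of \<open>f\<close> to a Gaussian weight \<open>w\<close>. Clamping the ratio to \<open>[0, k]\<close> and multiplying by
  \<open>w\<close> again gives continuous functions dominated by the integrable function \<open>k * w\<close>; they converge
  to \<open>min f (k * w)\<close>, which tends to \<open>f\<close> as \<open>k\<close> grows.
\<close>

lemma density_approx_continuous_integrable:
  assumes f: "f \<in> densities" and "0 < \<delta>"
  obtains c B where "integrable lborel c" "continuous_on UNIV c" "\<And>x. 0 \<le> c x" "\<And>x. c x \<le> B"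
    "L1_norm (\<lambda>x. c x - f x) < \<delta>"
proof -
  let ?w = std_normal_density
  have w_pos: "0 < ?w x" for x by (simp add: normal_density_pos)
  have w_le: "?w x \<le> 1 / sqrt (2 * pi)" for x using normal_density_le[of 0 1 x] by simp
  have fint: "integrable lborel f" using f by (rule densities_integrable)
  have fnn: "0 \<le> f x" for x using f by (simp add: densities_def)
  have [measurable]: "f \<in> borel_measurable borel" using f by (simp add: densities_def)
  have lim_k: "(\<lambda>k. LINT x|lborel. \<bar>min (f x) (real k * ?w x) - f x\<bar>) \<longlonglongrightarrow> integral\<^sup>L lborel (\<lambda>x::real. 0)"
  proof (rule integral_dominated_convergence[where w = f])
    have "(\<lambda>k. \<bar>min (f x) (real k * ?w x) - f x\<bar>) \<longlonglongrightarrow> 0" for x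
    proof (rule tendsto_eventually)
      obtain K :: nat where K: "f x / ?w x \<le> real K" using real_arch_simple by blast
      have "f x \<le> real k * ?w x" if "K \<le> k" for k
      proof -
        have "f x \<le> real K * ?w x" using K w_pos[of x] by (simp add: pos_divide_le_eq)
        also have "\<dots> \<le> real k * ?w x" using that w_pos[of x] by (intro mult_right_mono) auto
        finally show ?thesis .
      qed
      then show "\<forall>\<^sub>F k in sequentially. \<bar>min (f x) (real k * ?w x) - f x\<bar> = 0"
        unfolding eventually_sequentially by (intro exI[of _ K]) (auto simp: min_def)
    qed
    then show "AE x in lborel. (\<lambda>k. \<bar>min (f x) (real k * ?w x) - f x\<bar>) \<longlonglongrightarrow> 0" by simp
    have "\<bar>min (f x) (real k * ?w x) - f x\<bar> \<le> f x" for k x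
      using fnn[of x] w_pos[of x] by (auto simp: min_def)
    then show "AE x in lborel. norm \<bar>min (f x) (real k * ?w x) - f x\<bar> \<le> f x" for k by simp
  qed (use fint in auto)
  then have "\<forall>\<^sub>F k in sequentially. (LINT x|lborel. \<bar>min (f x) (real k * ?w x) - f x\<bar>) < \<delta> / 2"
    using \<open>0 < \<delta>\<close> by (intro order_tendstoD(2)[OF lim_k]) simp
  then obtain k where k: "(LINT x|lborel. \<bar>min (f x) (real k * ?w x) - f x\<bar>) < \<delta> / 2"
    by (auto simp: eventually_sequentially)
  have "(\<lambda>x. f x / ?w x) \<in> borel_measurable borel" by measurable
  then obtain g where g: "\<And>n::nat. continuous_on UNIV (g n)"
    and g_lim: "AE x in lborel. (\<lambda>n. g n x) \<longlonglongrightarrow> f x / ?w x"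
    using AE_limit_of_continuous by blast
  define c where "c n x = ?w x * max 0 (min (g n x) (real k))" for n x
  have c_cont: "continuous_on UNIV (c n)" for n
    unfolding c_def normal_density_def by (intro continuous_intros g) auto
  have [measurable]: "c n \<in> borel_measurable borel" for n
    using borel_measurable_continuous_onI[OF c_cont] .
  have c_nn: "0 \<le> c n x" for n x using w_pos[of x] by (simp add: c_def)
  have c_le: "c n x \<le> real k * ?w x" for n x
    using w_pos[of x] by (simp add: c_def max_def min_def)
  have wint: "integrable lborel (\<lambda>x. real k * ?w x)" by simp
  have c_int: "integrable lborel (c n)" for n
    by (rule Bochner_Integration.integrable_bound[OF wint]) (use c_nn c_le w_pos in \<open>auto simp: less_imp_le\<close>)
  have min_int: "integrable lborel (\<lambda>x. min (f x) (real k * ?w x))"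
    using fint wint by (rule integrable_min)
  have lim_n: "(\<lambda>n. LINT x|lborel. \<bar>c n x - min (f x) (real k * ?w x)\<bar>) \<longlonglongrightarrow> integral\<^sup>L lborel (\<lambda>x::real. 0)"
  proof (rule integral_dominated_convergence[where w = "\<lambda>x. real k * ?w x"])
    show "AE x in lborel. (\<lambda>n. \<bar>c n x - min (f x) (real k * ?w x)\<bar>) \<longlonglongrightarrow> 0"
      using g_lim
    proof eventually_elim
      case (elim x)
      have "(\<lambda>n. c n x) \<longlonglongrightarrow> ?w x * max 0 (min (f x / ?w x) (real k))"
        unfolding c_def by (intro tendsto_intros elim)
      also have "?w x * max 0 (min (f x / ?w x) (real k)) = min (f x) (real k * ?w x)"
        using w_pos[of x] fnn[of x] by (auto simp: min_def max_def field_simps)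
      finally show ?case by (intro tendsto_rabs_zero) (rule LIM_zero)
    qed
    have "\<bar>c n x - min (f x) (real k * ?w x)\<bar> \<le> real k * ?w x" for n x
      using c_le[of n x] c_nn[of n x] fnn[of x] w_pos[of x] by (auto simp: min_def abs_le_iff)
    then show "AE x in lborel. norm \<bar>c n x - min (f x) (real k * ?w x)\<bar> \<le> real k * ?w x" for n by simp
  qed auto
  then have "\<forall>\<^sub>F n in sequentially. (LINT x|lborel. \<bar>c n x - min (f x) (real k * ?w x)\<bar>) < \<delta> / 2"
    using \<open>0 < \<delta>\<close> by (intro order_tendstoD(2)[OF lim_n]) simp
  then obtain n where n: "(LINT x|lborel. \<bar>c n x - min (f x) (real k * ?w x)\<bar>) < \<delta> / 2"
    by (auto simp: eventually_sequentially)
  have "L1_norm (\<lambda>x. c n x - f x)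
      \<le> (LINT x|lborel. \<bar>c n x - min (f x) (real k * ?w x)\<bar> + \<bar>min (f x) (real k * ?w x) - f x\<bar>)"
    unfolding L1_norm_def using c_int fint min_int
    by (intro integral_mono Bochner_Integration.integrable_add integrable_abs Bochner_Integration.integrable_diff) auto
  also have "\<dots> = (LINT x|lborel. \<bar>c n x - min (f x) (real k * ?w x)\<bar>)
      + (LINT x|lborel. \<bar>min (f x) (real k * ?w x) - f x\<bar>)"
    using c_int fint min_int
    by (intro Bochner_Integration.integral_add integrable_abs Bochner_Integration.integrable_diff)
  finally have "L1_norm (\<lambda>x. c n x - f x) < \<delta>" using k n by simp
  moreover have "c n x \<le> real k * (1 / sqrt (2 * pi))" for x
    using c_le[of n x] mult_left_mono[OF w_le[of x], of "real k"] by linarith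
  ultimately show ?thesis
    using that[of "c n"] c_int c_cont c_nn by blast
qed

text \<open>
  The mass of an approximating function differs from \<open>1\<close> by at most its \<open>L1\<close> distance to \<open>f\<close>, so
  normalising it at most doubles that distance.
\<close>

lemma density_approx_continuous_density:
  assumes f: "f \<in> densities" and "0 < \<epsilon>"
  obtains h B where "h \<in> densities" "continuous_on UNIV h" "\<And>x. h x \<le> B"
    "L1_norm (\<lambda>x. h x - f x) < \<epsilon>"
proof -
  have "0 < min (\<epsilon> / 2) (1 / 2)" using \<open>0 < \<epsilon>\<close> by simp
  from density_approx_continuous_integrable[OF f this] obtain c B
    where c: "integrable lborel c" "continuous_on UNIV c" "\<And>x. 0 \<le> c x" "\<And>x. c x \<le> B"
      and close: "L1_norm (\<lambda>x. c x - f x) < min (\<epsilon> / 2) (1 / 2)" by blast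
  have fint: "integrable lborel f" using f by (rule densities_integrable)
  define C where "C = (LINT x|lborel. c x)"
  have "C - 1 = (LINT x|lborel. c x - f x)"
    unfolding C_def using c(1) fint f by (subst Bochner_Integration.integral_diff) (auto simp: densities_def)
  then have C1: "\<bar>C - 1\<bar> \<le> L1_norm (\<lambda>x. c x - f x)"
    unfolding L1_norm_def using integral_abs_bound by metis
  then have C: "1 / 2 < C" using close by linarith
  define h where "h x = c x / C" for x
  have h: "h \<in> densities"
    using borel_measurable_integrable[OF c(1)] c C unfolding densities_def h_def
    by (auto simp: C_def[symmetric])
  have hint: "integrable lborel h" using h by (rule densities_integrable)
  have "L1_norm (\<lambda>x. h x - c x) = (LINT x|lborel. \<bar>1 / C - 1\<bar> * c x)"
    unfolding L1_norm_def
  proof (rule Bochner_Integration.integral_cong[OF refl])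
    fix x show "\<bar>h x - c x\<bar> = \<bar>1 / C - 1\<bar> * c x"
      using c(3)[of x] abs_mult[of "1 / C - 1" "c x"] by (simp add: h_def algebra_simps)
  qed
  also have "\<dots> = \<bar>1 / C - 1\<bar> * C" by (simp add: C_def)
  also have "\<dots> = \<bar>C - 1\<bar>" using C by (auto simp: abs_if field_simps)
  finally have hc: "L1_norm (\<lambda>x. h x - c x) = \<bar>C - 1\<bar>" .
  have "L1_norm (\<lambda>x. h x - f x) \<le> (LINT x|lborel. \<bar>h x - c x\<bar> + \<bar>c x - f x\<bar>)"
    unfolding L1_norm_def using c(1) fint hint
    by (intro integral_mono Bochner_Integration.integrable_add integrable_abs Bochner_Integration.integrable_diff) auto
  also have "\<dots> = L1_norm (\<lambda>x. h x - c x) + L1_norm (\<lambda>x. c x - f x)"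
    unfolding L1_norm_def using c(1) fint hint
    by (intro Bochner_Integration.integral_add integrable_abs Bochner_Integration.integrable_diff)
  finally have "L1_norm (\<lambda>x. h x - f x) < \<epsilon>" using hc C1 close by linarith
  moreover have "continuous_on UNIV h"
    unfolding h_def using c(2) C by (intro continuous_intros) auto
  moreover have "h x \<le> B / C" for x
    unfolding h_def using c(4) C by (intro divide_right_mono) auto
  ultimately show ?thesis using that h by blast
qed

section \<open>Smoothing a density by its quantile function\<close>

text \<open>
  The quantile function of \<open>h\<close> pushes the uniform distribution forward to the distribution with
  density \<open>h\<close>. Mixing over it therefore gives the convolution of \<open>h\<close> with a Gaussian kernel.
\<close>

lemma f_mix_quantile:
  assumes h: "h \<in> densities"
  obtains q where "q \<in> borel_measurable borel"
    "\<And>\<sigma> y. 0 < \<sigma> \<Longrightarrow> f_mix q \<sigma> y = (LINT t|lborel. h t * normal_density t \<sigma> y)"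
proof -
  let ?M = "density lborel h"
  let ?O = "restrict_space lborel {0<..<1::real}"
  have [measurable]: "h \<in> borel_measurable borel" and hnn: "\<And>x. 0 \<le> h x"
    using h by (auto simp: densities_def)
  have "emeasure ?M (space ?M) = 1"
    using densities_nn_integral[OF h] hnn by (simp add: emeasure_density)
  then have "prob_space ?M" by (rule prob_spaceI)
  then interpret M: cdf_distribution ?M
    unfolding cdf_distribution_def real_distribution_def real_distribution_axioms_def by simp
  (* Inf is arbitrary outside the open unit interval, hence the cut-off. *)
  define q where "q x = indicator {0<..<1} x * M.I x" for x :: real
  have q: "q \<in> borel_measurable borel"
    unfolding q_def using M.measurable_CI
    by (subst (asm) borel_measurable_restrict_space_iff) (auto simp: mult.commute)
  have I: "M.I \<in> measurable ?O borel"
    using M.measurable_CI by (subst measurable_cong_sets[OF sets_restrict_space_cong[OF sets_lborel] refl])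
  have "f_mix q \<sigma> y = (LINT t|lborel. h t * normal_density t \<sigma> y)" if "0 < \<sigma>" for \<sigma> y
  proof -
    (* The quantile function lives on the open interval, the mixture on the closed one. *)
    have ae: "AE x in lborel. x \<noteq> 0 \<and> x \<noteq> (1::real)"
      using AE_lborel_singleton[of 0] AE_lborel_singleton[of 1] by eventually_elim simp
    have [measurable]: "(\<lambda>x. normal_density (q x) \<sigma> y) \<in> borel_measurable lborel" using q by measurable
    have "f_mix q \<sigma> y = (LINT x|lborel. indicator {0..1} x *\<^sub>R normal_density (q x) \<sigma> y)"
      using that by (simp add: f_mix_eq integral_restrict_space)
    also have "\<dots> = (LINT x|lborel. indicator {0<..<1} x *\<^sub>R normal_density (q x) \<sigma> y)"
    proof (rule integral_cong_AE)
      show "AE x in lborel. indicator {0..1} x *\<^sub>R normal_density (q x) \<sigma> y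
          = indicator {0<..<1} x *\<^sub>R normal_density (q x) \<sigma> y"
        using ae by eventually_elim (auto simp: indicator_def)
    qed measurable
    also have "\<dots> = (LINT x|?O. normal_density (q x) \<sigma> y)"
      by (simp add: integral_restrict_space)
    also have "\<dots> = (LINT x|?O. normal_density (M.I x) \<sigma> y)"
      by (rule Bochner_Integration.integral_cong) (auto simp: q_def space_restrict_space)
    also have "\<dots> = (LINT t|distr ?O borel M.I. normal_density t \<sigma> y)"
      by (rule integral_distr[symmetric, OF I]) measurable
    also have "\<dots> = (LINT t|?M. normal_density t \<sigma> y)" unfolding M.distr_I_eq_M ..
    also have "\<dots> = (LINT t|lborel. h t * normal_density t \<sigma> y)"
      using hnn by (subst integral_density) auto
    finally show ?thesis .
  qed
  then show ?thesis using that q by blast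
qed

text \<open>
  The substitution \<open>t = y + \<sigma> * z\<close> moves the scale from the kernel into \<open>h\<close>, where continuity and
  boundedness of \<open>h\<close> allow dominated convergence.
\<close>

lemma gaussian_smoothing_tendsto:
  assumes h: "continuous_on UNIV h" "\<And>x::real. \<bar>h x\<bar> \<le> B"
    and s: "\<And>n. 0 < \<sigma>s n" "\<sigma>s \<longlonglongrightarrow> 0"
  shows "(\<lambda>n. LINT t|lborel. h t * normal_density t (\<sigma>s n) y) \<longlonglongrightarrow> h y"
proof -
  have [measurable]: "h \<in> borel_measurable borel" using borel_measurable_continuous_onI h by blast
  have eq: "(LINT t|lborel. h t * normal_density t \<sigma> y)
      = (LINT z|lborel. h (y + \<sigma> * z) * std_normal_density z)" if "0 < \<sigma>" for \<sigma>
  proof -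
    have "(LINT t|lborel. h t * normal_density t \<sigma> y)
        = (LINT z|lborel. \<sigma> * (h (y + \<sigma> * z) * normal_density (y + \<sigma> * z) \<sigma> y))"
      using that lborel_integral_real_affine[of \<sigma> "\<lambda>t. h t * normal_density t \<sigma> y" y] by simp
    also have "\<dots> = (LINT z|lborel. h (y + \<sigma> * z) * std_normal_density z)"
    proof (rule Bochner_Integration.integral_cong[OF refl])
      fix z
      have "\<sigma> * normal_density (y + \<sigma> * z) \<sigma> y = std_normal_density z"
        using that by (simp add: normal_density_def real_sqrt_mult power_mult_distrib)
      then show "\<sigma> * (h (y + \<sigma> * z) * normal_density (y + \<sigma> * z) \<sigma> y)
          = h (y + \<sigma> * z) * std_normal_density z"
        by (simp add: mult.left_commute)
    qed
    finally show ?thesis .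
  qed
  have "(\<lambda>n. LINT z|lborel. h (y + \<sigma>s n * z) * std_normal_density z)
      \<longlonglongrightarrow> (LINT z|lborel. h y * std_normal_density z)"
  proof (rule integral_dominated_convergence[where w = "\<lambda>z. B * std_normal_density z"])
    have "(\<lambda>n. h (y + \<sigma>s n * z)) \<longlonglongrightarrow> h y" for z
    proof -
      have "isCont h y" using h(1) by (simp add: continuous_on_eq_continuous_at)
      moreover have "(\<lambda>n. y + \<sigma>s n * z) \<longlonglongrightarrow> y + 0 * z" by (intro tendsto_intros s)
      ultimately show ?thesis using isCont_tendsto_compose[of y h] by simp
    qed
    then show "AE z in lborel. (\<lambda>n. h (y + \<sigma>s n * z) * std_normal_density z)
        \<longlonglongrightarrow> h y * std_normal_density z"
      by (intro always_eventually allI tendsto_mult_right)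
    show "AE z in lborel. norm (h (y + \<sigma>s n * z) * std_normal_density z) \<le> B * std_normal_density z" for n
      using h(2) by (auto simp: abs_mult intro!: mult_right_mono)
  qed auto
  then show ?thesis using s(1) by (simp add: eq)
qed

text \<open>
  Three replacements, each costing a third of \<open>\<epsilon>\<close>: the density by a bounded continuous one \<open>h\<close>, then \<open>h\<close>
  by its Gaussian smoothing, which is the mixture over the quantile function of \<open>h\<close>, and finally the
  quantile function by a continuous function.
\<close>

lemma f_mix_approximates_density:
  assumes f: "f \<in> densities" and "0 < \<epsilon>"
  obtains \<mu> \<sigma> where "continuous_on UNIV \<mu>" "0 < \<sigma>" "L1_norm (\<lambda>y. f_mix \<mu> \<sigma> y - f y) < \<epsilon>"
proof -
  have pos: "0 < \<epsilon> / 3" using \<open>0 < \<epsilon>\<close> by simp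
  obtain h B where h: "h \<in> densities" "continuous_on UNIV h" "\<And>x. h x \<le> B"
    and hf: "L1_norm (\<lambda>x. h x - f x) < \<epsilon> / 3"
    using density_approx_continuous_density[OF f pos] by blast
  obtain q where q: "q \<in> borel_measurable borel"
    and q_mix: "\<And>\<sigma> y. 0 < \<sigma> \<Longrightarrow> f_mix q \<sigma> y = (LINT t|lborel. h t * normal_density t \<sigma> y)"
    using f_mix_quantile[OF h(1)] by blast
  have q_unit: "q \<in> borel_measurable unit_lebesgue"
    using q by (intro measurable_restrict_space1) simp
  let ?s = "\<lambda>n. 1 / real (Suc n)"
  have "\<bar>h x\<bar> \<le> B" for x using h(1) h(3)[of x] by (simp add: densities_def)
  then have "(\<lambda>n. f_mix q (?s n) y) \<longlonglongrightarrow> h y" for y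
    using gaussian_smoothing_tendsto[OF h(2), of B ?s y] LIMSEQ_Suc[OF lim_1_over_n]
    by (simp add: q_mix)
  then have "(\<lambda>n. L1_norm (\<lambda>y. f_mix q (?s n) y - h y)) \<longlonglongrightarrow> 0"
    by (intro densities_tendsto_L1 f_mix_in_densities q_unit h(1)) auto
  from order_tendstoD(2)[OF this pos] obtain n
    where n: "L1_norm (\<lambda>y. f_mix q (?s n) y - h y) < \<epsilon> / 3"
    by (auto simp: eventually_sequentially)
  define \<sigma> where "\<sigma> = ?s n"
  have \<sigma>: "0 < \<sigma>" by (simp add: \<sigma>_def)
  obtain g where g: "\<And>n::nat. continuous_on UNIV (g n)"
    and g_lim: "AE x in lborel. (\<lambda>n. g n x) \<longlonglongrightarrow> q x"
    using AE_limit_of_continuous[OF q] by blast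
  have g_unit: "g n \<in> borel_measurable unit_lebesgue" for n
    using g continuous_on_subset by (blast intro: continuous_on_unit_measurable)
  have "AE x in unit_lebesgue. (\<lambda>n. g n x) \<longlonglongrightarrow> q x"
    using g_lim by (subst AE_restrict_space_iff) auto
  then have "(\<lambda>n. L1_norm (\<lambda>y. f_mix (g n) \<sigma> y - f_mix q \<sigma> y)) \<longlonglongrightarrow> 0"
    using \<sigma> by (intro f_mix_tendsto_L1 g_unit q_unit) auto
  from order_tendstoD(2)[OF this pos] obtain m
    where m: "L1_norm (\<lambda>y. f_mix (g m) \<sigma> y - f_mix q \<sigma> y) < \<epsilon> / 3"
    by (auto simp: eventually_sequentially)
  have dens: "f_mix (g m) \<sigma> \<in> densities" "f_mix q \<sigma> \<in> densities"
    using f_mix_in_densities g_unit q_unit \<sigma> by blast+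
  have "L1_norm (\<lambda>y. f_mix (g m) \<sigma> y - f y) < \<epsilon>"
    using L1_norm_triangle[OF dens(1,2) f] L1_norm_triangle[OF dens(2) h(1) f] m n hf
    by (simp add: \<sigma>_def)
  then show ?thesis using that g \<sigma> by blast
qed

section \<open>Measurability of the mixture map\<close>

lemma mspace_C01_unit_measurable: "\<mu> \<in> mspace C01 \<Longrightarrow> \<mu> \<in> borel_measurable unit_lebesgue"
  by (simp add: mspace_C01 continuous_on_unit_measurable)

lemma abs_diff_le_mdist_C01:
  assumes "f \<in> mspace C01" "g \<in> mspace C01" "x \<in> {0..1}"
  shows "\<bar>f x - g x\<bar> \<le> mdist C01 f g"
proof -
  have "continuous_on {0..1} (\<lambda>x. \<bar>f x - g x\<bar>)"
    using assms by (intro continuous_intros) (auto simp: mspace_C01)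
  then have "compact ((\<lambda>x. \<bar>f x - g x\<bar>) ` {0..1})"
    by (rule compact_continuous_image) simp
  then show ?thesis
    unfolding mdist_C01[OF assms(1,2)]
    by (intro cSUP_upper assms(3) bounded_imp_bdd_above compact_imp_bounded)
qed

text \<open>
  Continuity of the mixture map at \<open>(\<mu>, \<sigma>)\<close>. If it failed, there would be a sequence converging
  uniformly to \<open>\<mu>\<close>, with scales converging to \<open>\<sigma>\<close>, along which the mixtures stay apart.
\<close>

lemma f_mix_continuous_C01:
  assumes "\<mu> \<in> mspace C01" "0 < \<sigma>" "0 < \<epsilon>"
  obtains \<delta> where "0 < \<delta>"
    "\<And>\<nu> \<tau>. \<nu> \<in> mspace C01 \<Longrightarrow> mdist C01 \<mu> \<nu> < \<delta> \<Longrightarrow> 0 < \<tau> \<Longrightarrow> \<bar>\<tau> - \<sigma>\<bar> < \<delta> \<Longrightarrow>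
      L1_norm (\<lambda>y. f_mix \<nu> \<tau> y - f_mix \<mu> \<sigma> y) < \<epsilon>"
proof -
  have "\<exists>\<delta>>0. \<forall>\<nu> \<tau>. \<nu> \<in> mspace C01 \<and> mdist C01 \<mu> \<nu> < \<delta> \<and> 0 < \<tau> \<and> \<bar>\<tau> - \<sigma>\<bar> < \<delta> \<longrightarrow>
      L1_norm (\<lambda>y. f_mix \<nu> \<tau> y - f_mix \<mu> \<sigma> y) < \<epsilon>" (is "\<exists>\<delta>>0. ?P \<delta>")
  proof (rule ccontr)
    assume "\<not> (\<exists>\<delta>>0. ?P \<delta>)"
    then have "\<not> ?P (1 / real (Suc n))" for n
      using zero_less_divide_1_iff of_nat_0_less_iff by blast
    then have "\<exists>\<nu> \<tau>. \<nu> \<in> mspace C01 \<and> mdist C01 \<mu> \<nu> < 1 / real (Suc n) \<and> 0 < \<tau>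
        \<and> \<bar>\<tau> - \<sigma>\<bar> < 1 / real (Suc n) \<and> \<not> L1_norm (\<lambda>y. f_mix \<nu> \<tau> y - f_mix \<mu> \<sigma> y) < \<epsilon>" for n
      by blast
    then obtain \<nu> \<tau> where \<nu>: "\<And>n. \<nu> n \<in> mspace C01" "\<And>n. mdist C01 \<mu> (\<nu> n) < 1 / real (Suc n)"
      and \<tau>: "\<And>n. 0 < \<tau> n" "\<And>n. \<bar>\<tau> n - \<sigma>\<bar> < 1 / real (Suc n)"
      and far: "\<And>n. \<not> L1_norm (\<lambda>y. f_mix (\<nu> n) (\<tau> n) y - f_mix \<mu> \<sigma> y) < \<epsilon>"
      by metis
    have inv: "(\<lambda>n. 1 / real (Suc n)) \<longlonglongrightarrow> 0" using LIMSEQ_Suc[OF lim_1_over_n] by simp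
    have \<nu>_lim: "(\<lambda>n. \<nu> n x) \<longlonglongrightarrow> \<mu> x" if "x \<in> {0..1}" for x
    proof -
      have "\<bar>\<nu> n x - \<mu> x\<bar> \<le> 1 / real (Suc n)" for n
        using abs_diff_le_mdist_C01[OF assms(1) \<nu>(1)[of n] that] \<nu>(2)[of n] by linarith
      then have "(\<lambda>n. \<nu> n x - \<mu> x) \<longlonglongrightarrow> 0"
        by (intro Lim_null_comparison[OF _ inv]) simp
      then show ?thesis by (rule LIM_zero_cancel)
    qed
    have "(\<lambda>n. \<tau> n - \<sigma>) \<longlonglongrightarrow> 0"
      using \<tau>(2) by (intro Lim_null_comparison[OF _ inv]) (simp add: less_imp_le)
    then have "\<tau> \<longlonglongrightarrow> \<sigma>" by (rule LIM_zero_cancel)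
    moreover have "AE x in unit_lebesgue. (\<lambda>n. \<nu> n x) \<longlonglongrightarrow> \<mu> x"
      using \<nu>_lim by (intro AE_I2) (simp add: space_restrict_space)
    ultimately have "(\<lambda>n. L1_norm (\<lambda>y. f_mix (\<nu> n) (\<tau> n) y - f_mix \<mu> \<sigma> y)) \<longlonglongrightarrow> 0"
      using assms(1,2) \<nu>(1) \<tau>(1) by (intro f_mix_tendsto_L1 mspace_C01_unit_measurable)
    from order_tendstoD(2)[OF this \<open>0 < \<epsilon>\<close>] far show False
      by (auto simp: eventually_sequentially)
  qed
  then show ?thesis using that by blast
qed

lemma L1_ball_openin:
  assumes "f0 \<in> densities" "f \<in> L1_ball f0 \<epsilon>"
  shows "\<exists>\<delta>>0. L1_ball f \<delta> \<subseteq> L1_ball f0 \<epsilon>"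
proof (intro exI conjI subsetI)
  have f: "f \<in> densities" "L1_norm (\<lambda>x. f x - f0 x) < \<epsilon>" using assms(2) by (auto simp: L1_ball_def)
  show "0 < \<epsilon> - L1_norm (\<lambda>x. f x - f0 x)" using f by simp
  fix g assume "g \<in> L1_ball f (\<epsilon> - L1_norm (\<lambda>x. f x - f0 x))"
  then have g: "g \<in> densities" "L1_norm (\<lambda>x. g x - f x) < \<epsilon> - L1_norm (\<lambda>x. f x - f0 x)"
    by (auto simp: L1_ball_def)
  with L1_norm_triangle[OF g(1) f(1) assms(1)] show "g \<in> L1_ball f0 \<epsilon>"
    by (simp add: L1_ball_def)
qed

lemma L1_ball_sets: "f0 \<in> densities \<Longrightarrow> L1_ball f0 \<epsilon> \<in> sets density_space"
  unfolding density_space_def using L1_ball_openin[of f0]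
  by (subst sets_measure_of) (auto simp: L1_ball_def)

lemma space_borel_C01: "space borel_C01 = mspace C01"
  unfolding borel_C01_def using openin_subset by (subst space_measure_of) fastforce+

lemma openin_C01_sets: "openin (mtopology_of C01) U \<Longrightarrow> U \<in> sets borel_C01"
  unfolding borel_C01_def using openin_subset by (subst sets_measure_of) fastforce+

lemma mball_C01_sets:
  assumes "\<mu> \<in> mspace C01"
  shows "{\<nu> \<in> mspace C01. mdist C01 \<mu> \<nu> < \<delta>} \<in> sets borel_C01"
proof -
  interpret Metric_space "mspace C01" "mdist C01" by blast
  have "{\<nu> \<in> mspace C01. mdist C01 \<mu> \<nu> < \<delta>} = mball \<mu> \<delta>"
    using assms by (auto simp: in_mball)
  then show ?thesis
    using openin_mball[of \<mu> \<delta>] by (auto intro!: openin_C01_sets simp: mtopology_of_def)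
qed

text \<open>
  An open subset of a product lies in the product sigma-algebra as soon as one factor has a countable
  base. Here the base of rational intervals of the second factor is used: for each such interval, let
  \<open>A\<close> be the largest open set whose product with the interval is contained in \<open>W\<close>; then \<open>W\<close> is the
  union of these countably many rectangles.
\<close>

lemma open_C01_times_pos_sets:
  fixes N :: "real measure"
  assumes M: "sets M = sets borel_C01" and N: "sets N = sets (restrict_space borel {0..})"
    and W: "W \<subseteq> mspace C01 \<times> {0<..}"
    and open_W: "\<And>\<mu> \<sigma>. (\<mu>, \<sigma>) \<in> W \<Longrightarrow> \<exists>\<delta>>0. \<forall>\<nu> \<tau>. \<nu> \<in> mspace C01 \<and> mdist C01 \<mu> \<nu> < \<delta> \<and>
        0 < \<tau> \<and> \<bar>\<tau> - \<sigma>\<bar> < \<delta> \<longrightarrow> (\<nu>, \<tau>) \<in> W"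
  shows "W \<in> sets (M \<Otimes>\<^sub>M N)"
proof -
  interpret Metric_space "mspace C01" "mdist C01" by blast
  define A where "A a b = \<Union> {U. openin (mtopology_of C01) U \<and> U \<times> {a<..<b} \<subseteq> W}" for a b :: real
  define Q where "Q = {(a, b :: real). a \<in> \<rat> \<and> b \<in> \<rat> \<and> (0::real) < a}"
  have W_eq: "W = (\<Union>(a, b)\<in>Q. A a b \<times> {a<..<b})"
  proof (rule antisym)
    show "(\<Union>(a, b)\<in>Q. A a b \<times> {a<..<b}) \<subseteq> W" by (auto simp: A_def)
    show "W \<subseteq> (\<Union>(a, b)\<in>Q. A a b \<times> {a<..<b})"
    proof clarify
      fix \<mu> \<sigma> assume in_W: "(\<mu>, \<sigma>) \<in> W"
      then obtain \<delta> where \<delta>: "0 < \<delta>" and sub: "\<And>\<nu> \<tau>. \<nu> \<in> mspace C01 \<Longrightarrow> mdist C01 \<mu> \<nu> < \<delta> \<Longrightarrow>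
          0 < \<tau> \<Longrightarrow> \<bar>\<tau> - \<sigma>\<bar> < \<delta> \<Longrightarrow> (\<nu>, \<tau>) \<in> W"
        using open_W by meson
      have \<mu>: "\<mu> \<in> mspace C01" and \<sigma>: "0 < \<sigma>" using W in_W by auto
      obtain a where a: "a \<in> \<rat>" "max 0 (\<sigma> - \<delta>) < a" "a < \<sigma>"
        using Rats_dense_in_real[of "max 0 (\<sigma> - \<delta>)" \<sigma>] \<sigma> \<delta> by auto
      obtain b where b: "b \<in> \<rat>" "\<sigma> < b" "b < \<sigma> + \<delta>"
        using Rats_dense_in_real[of \<sigma> "\<sigma> + \<delta>"] \<delta> by auto
      have "mball \<mu> \<delta> \<times> {a<..<b} \<subseteq> W"
        using a b sub by (auto simp: in_mball abs_less_iff)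
      moreover have "openin (mtopology_of C01) (mball \<mu> \<delta>)"
        by (simp add: mtopology_of_def)
      moreover have "\<mu> \<in> mball \<mu> \<delta>" using \<mu> \<delta> by simp
      ultimately have "\<mu> \<in> A a b" unfolding A_def by blast
      then show "(\<mu>, \<sigma>) \<in> (\<Union>(a, b)\<in>Q. A a b \<times> {a<..<b})"
        using a b by (auto simp: Q_def)
    qed
  qed
  have "countable Q"
    by (rule countable_subset[of _ "\<rat> \<times> \<rat>"]) (auto simp: Q_def countable_rat)
  moreover have "A a b \<times> {a<..<b} \<in> sets (M \<Otimes>\<^sub>M N)" if "(a, b) \<in> Q" for a b
  proof (rule pair_measureI)
    show "A a b \<in> sets M"
      unfolding M A_def by (intro openin_C01_sets openin_Union) auto
    have "{a<..<b} \<subseteq> {0..}" using that by (auto simp: Q_def)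
    then show "{a<..<b} \<in> sets N"
      unfolding N by (subst sets_restrict_space_iff) auto
  qed
  ultimately show ?thesis
    unfolding W_eq by (intro sets.countable_UN') auto
qed

text \<open>
  The set is open by continuity of the mixture map, hence measurable.
\<close>

lemma f_mix_preimage_sets:
  fixes N :: "real measure"
  assumes M: "sets M = sets borel_C01" and N: "sets N = sets (restrict_space borel {0..})"
    and U: "\<And>f. f \<in> U \<Longrightarrow> \<exists>\<epsilon>>0. L1_ball f \<epsilon> \<subseteq> U"
  shows "{(\<mu>, \<sigma>). \<mu> \<in> mspace C01 \<and> 0 < \<sigma> \<and> f_mix \<mu> \<sigma> \<in> U} \<in> sets (M \<Otimes>\<^sub>M N)"
proof (rule open_C01_times_pos_sets[OF M N])
  fix \<mu> \<sigma> assume "(\<mu>, \<sigma>) \<in> {(\<mu>, \<sigma>). \<mu> \<in> mspace C01 \<and> 0 < \<sigma> \<and> f_mix \<mu> \<sigma> \<in> U}"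
  then have \<mu>: "\<mu> \<in> mspace C01" "0 < \<sigma>" and in_U: "f_mix \<mu> \<sigma> \<in> U" by auto
  obtain \<epsilon> where \<epsilon>: "0 < \<epsilon>" "L1_ball (f_mix \<mu> \<sigma>) \<epsilon> \<subseteq> U" using U[OF in_U] by blast
  obtain \<delta> where \<delta>: "0 < \<delta>"
    "\<And>\<nu> \<tau>. \<nu> \<in> mspace C01 \<Longrightarrow> mdist C01 \<mu> \<nu> < \<delta> \<Longrightarrow> 0 < \<tau> \<Longrightarrow> \<bar>\<tau> - \<sigma>\<bar> < \<delta> \<Longrightarrow>
      L1_norm (\<lambda>y. f_mix \<nu> \<tau> y - f_mix \<mu> \<sigma> y) < \<epsilon>"
    using f_mix_continuous_C01[OF \<mu> \<epsilon>(1)] by blast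
  have "f_mix \<nu> \<tau> \<in> U"
    if "\<nu> \<in> mspace C01" "mdist C01 \<mu> \<nu> < \<delta>" "0 < \<tau>" "\<bar>\<tau> - \<sigma>\<bar> < \<delta>" for \<nu> \<tau>
    using \<delta>(2)[OF that] that \<epsilon>(2) f_mix_in_densities[OF mspace_C01_unit_measurable, of \<nu> \<tau>]
    by (auto simp: L1_ball_def)
  then show "\<exists>\<delta>>0. \<forall>\<nu> \<tau>. \<nu> \<in> mspace C01 \<and> mdist C01 \<mu> \<nu> < \<delta> \<and> 0 < \<tau> \<and> \<bar>\<tau> - \<sigma>\<bar> < \<delta> \<longrightarrow>
      (\<nu>, \<tau>) \<in> {(\<mu>, \<sigma>). \<mu> \<in> mspace C01 \<and> 0 < \<sigma> \<and> f_mix \<mu> \<sigma> \<in> U}"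
    using \<delta>(1) by auto
qed auto

lemma space_pair_prior:
  fixes N :: "real measure"
  assumes "sets M = sets borel_C01" "sets N = sets (restrict_space borel {0..})"
  shows "space (M \<Otimes>\<^sub>M N) = mspace C01 \<times> {0..}"
  using sets_eq_imp_space_eq[OF assms(1)] sets_eq_imp_space_eq[OF assms(2)]
  by (simp add: space_pair_measure space_borel_C01 space_restrict_space)

lemma positive_scale_sets:
  fixes N :: "real measure"
  assumes M: "sets M = sets borel_C01" and N: "sets N = sets (restrict_space borel {0..})"
  shows "{(\<mu>, \<sigma>). 0 < \<sigma>} \<inter> space (M \<Otimes>\<^sub>M N) \<in> sets (M \<Otimes>\<^sub>M N)"
proof -
  have "{(\<mu>, \<sigma>). \<mu> \<in> mspace C01 \<and> 0 < \<sigma> \<and> f_mix \<mu> \<sigma> \<in> UNIV} \<in> sets (M \<Otimes>\<^sub>M N)"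
    by (rule f_mix_preimage_sets[OF M N]) (auto intro: exI[of _ 1])
  moreover have "{(\<mu>, \<sigma>). \<mu> \<in> mspace C01 \<and> 0 < \<sigma> \<and> f_mix \<mu> \<sigma> \<in> UNIV}
      = {(\<mu>, \<sigma>). 0 < \<sigma>} \<inter> space (M \<Otimes>\<^sub>M N)"
    by (auto simp: space_pair_prior[OF M N])
  ultimately show ?thesis by simp
qed

lemma f_mix_measurable:
  fixes N :: "real measure"
  assumes M: "sets M = sets borel_C01" and N: "sets N = sets (restrict_space borel {0..})"
  shows "(\<lambda>(\<mu>, \<sigma>). f_mix \<mu> \<sigma>)
    \<in> measurable (restrict_space (M \<Otimes>\<^sub>M N) {(\<mu>, \<sigma>). 0 < \<sigma>}) density_space"
  unfolding density_space_def
proof (rule measurable_measure_of)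
  show "(\<lambda>(\<mu>, \<sigma>). f_mix \<mu> \<sigma>) \<in> space (restrict_space (M \<Otimes>\<^sub>M N) {(\<mu>, \<sigma>). 0 < \<sigma>}) \<rightarrow> densities"
    by (auto simp: space_restrict_space space_pair_prior[OF M N]
        intro!: f_mix_in_densities mspace_C01_unit_measurable)
  fix U assume U: "U \<in> {U. U \<subseteq> densities \<and> (\<forall>f\<in>U. \<exists>\<epsilon>>0. L1_ball f \<epsilon> \<subseteq> U)}"
  have "(\<lambda>(\<mu>, \<sigma>). f_mix \<mu> \<sigma>) -` U \<inter> space (restrict_space (M \<Otimes>\<^sub>M N) {(\<mu>, \<sigma>). 0 < \<sigma>})
      = {(\<mu>, \<sigma>). \<mu> \<in> mspace C01 \<and> 0 < \<sigma> \<and> f_mix \<mu> \<sigma> \<in> U}"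
    by (auto simp: space_restrict_space space_pair_prior[OF M N])
  then show "(\<lambda>(\<mu>, \<sigma>). f_mix \<mu> \<sigma>) -` U \<inter> space (restrict_space (M \<Otimes>\<^sub>M N) {(\<mu>, \<sigma>). 0 < \<sigma>})
      \<in> sets (restrict_space (M \<Otimes>\<^sub>M N) {(\<mu>, \<sigma>). 0 < \<sigma>})"
    using f_mix_preimage_sets[OF M N, of U] U
    by (subst sets_restrict_space_iff[OF positive_scale_sets[OF M N]]) auto
qed auto

lemma induced_prior_L1_ball:
  fixes N :: "real measure"
  assumes M: "sets M = sets borel_C01" and N: "sets N = sets (restrict_space borel {0..})"
    and f0: "f0 \<in> densities"
  shows "emeasure (induced_prior M N) (L1_ball f0 \<epsilon>) = emeasure (M \<Otimes>\<^sub>M N)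
    {(\<mu>, \<sigma>). \<mu> \<in> mspace C01 \<and> 0 < \<sigma> \<and> L1_norm (\<lambda>y. f_mix \<mu> \<sigma> y - f0 y) < \<epsilon>}"
proof -
  let ?R = "restrict_space (M \<Otimes>\<^sub>M N) {(\<mu>, \<sigma>). 0 < \<sigma>}"
  have pre: "(\<lambda>(\<mu>, \<sigma>). f_mix \<mu> \<sigma>) -` L1_ball f0 \<epsilon> \<inter> space ?R
      = {(\<mu>, \<sigma>). \<mu> \<in> mspace C01 \<and> 0 < \<sigma> \<and> L1_norm (\<lambda>y. f_mix \<mu> \<sigma> y - f0 y) < \<epsilon>}"
    by (auto simp: space_restrict_space space_pair_prior[OF M N] L1_ball_def
        intro!: f_mix_in_densities mspace_C01_unit_measurable)
  show ?thesis
    unfolding induced_prior_def emeasure_distr[OF f_mix_measurable[OF M N] L1_ball_sets[OF f0]] pre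
    by (rule emeasure_restrict_space[OF positive_scale_sets[OF M N]]) auto
qed

section \<open>Full support of the induced prior\<close>

theorem theorem4p1:
  fixes \<Pi>\<mu> :: "(real \<Rightarrow> real) measure" and \<Pi>\<sigma> :: "real measure" and f0 :: "real \<Rightarrow> real"
  assumes "prob_space \<Pi>\<mu>" and "sets \<Pi>\<mu> = sets borel_C01"
    and "\<And>\<mu>0 \<epsilon>. \<mu>0 \<in> mspace C01 \<Longrightarrow> 0 < \<epsilon> \<Longrightarrow>
           0 < emeasure \<Pi>\<mu> {\<mu> \<in> mspace C01. mdist C01 \<mu> \<mu>0 < \<epsilon>}"
    and "prob_space \<Pi>\<sigma>" and "sets \<Pi>\<sigma> = sets (restrict_space borel {0..})"
    and "\<And>U. openin (top_of_set {0..}) U \<Longrightarrow> U \<noteq> {} \<Longrightarrow> 0 < emeasure \<Pi>\<sigma> U"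
    and "f0 \<in> densities"
    and "integrable lborel (\<lambda>x. \<bar>x\<bar> * f0 x)"
    and "AE x in lborel. x \<in> density_support f0 \<longrightarrow> f0 x \<noteq> 0"
  shows "f0 \<in> L1_support (induced_prior \<Pi>\<mu> \<Pi>\<sigma>) \<and>
    (\<forall>\<epsilon>>0. emeasure (induced_prior \<Pi>\<mu> \<Pi>\<sigma>) (L1_ball f0 \<epsilon>)
              = emeasure (\<Pi>\<mu> \<Otimes>\<^sub>M \<Pi>\<sigma>) {(\<mu>, \<sigma>). \<mu> \<in> mspace C01 \<and> 0 < \<sigma> \<and> L1_norm (\<lambda>y. f_mix \<mu> \<sigma> y - f0 y) < \<epsilon>} \<and>
            0 < emeasure (\<Pi>\<mu> \<Otimes>\<^sub>M \<Pi>\<sigma>) {(\<mu>, \<sigma>). \<mu> \<in> mspace C01 \<and> 0 < \<sigma> \<and> L1_norm (\<lambda>y. f_mix \<mu> \<sigma> y - f0 y) < \<epsilon>})"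
proof -
  note M = assms(2) and N = assms(5) and f0 = assms(7)
  interpret S: prob_space \<Pi>\<sigma> by fact
  have pos: "0 < emeasure (\<Pi>\<mu> \<Otimes>\<^sub>M \<Pi>\<sigma>)
      {(\<mu>, \<sigma>). \<mu> \<in> mspace C01 \<and> 0 < \<sigma> \<and> L1_norm (\<lambda>y. f_mix \<mu> \<sigma> y - f0 y) < \<epsilon>}"
    (is "0 < emeasure _ (?W \<epsilon>)") if "0 < \<epsilon>" for \<epsilon>
  proof -
    have half: "0 < \<epsilon> / 2" using that by simp
    obtain m \<sigma> where m: "continuous_on UNIV m" "0 < \<sigma>"
      and near: "L1_norm (\<lambda>y. f_mix m \<sigma> y - f0 y) < \<epsilon> / 2"
      using f_mix_approximates_density[OF f0 half] by blast
    (* Elements of the function space carry the default value outside the unit interval. *)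
    define \<mu> where "\<mu> = restrict m {0..1}"
    have "continuous_on {0..1} \<mu>"
      using continuous_on_subset[OF m(1) subset_UNIV]
      by (subst continuous_on_cong[OF refl, of _ _ m]) (auto simp: \<mu>_def)
    then have \<mu>: "\<mu> \<in> mspace C01" by (simp add: mspace_C01 \<mu>_def)
    have "f_mix \<mu> \<sigma> = f_mix m \<sigma>"
      unfolding f_mix_def set_lebesgue_integral_def \<mu>_def
      by (intro ext Bochner_Integration.integral_cong) (auto simp: indicator_def)
    with near have near: "L1_norm (\<lambda>y. f_mix \<mu> \<sigma> y - f0 y) < \<epsilon> / 2" by simp
    obtain \<delta> where \<delta>: "0 < \<delta>"
      "\<And>\<nu> \<tau>. \<nu> \<in> mspace C01 \<Longrightarrow> mdist C01 \<mu> \<nu> < \<delta> \<Longrightarrow> 0 < \<tau> \<Longrightarrow> \<bar>\<tau> - \<sigma>\<bar> < \<delta> \<Longrightarrow>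
        L1_norm (\<lambda>y. f_mix \<nu> \<tau> y - f_mix \<mu> \<sigma> y) < \<epsilon> / 2"
      using f_mix_continuous_C01[OF \<mu> m(2) half] by blast
    let ?A = "{\<nu> \<in> mspace C01. mdist C01 \<nu> \<mu> < \<delta>}" and ?B = "{max 0 (\<sigma> - \<delta>)<..<\<sigma> + \<delta>}"
    have "?A \<times> ?B \<subseteq> ?W \<epsilon>"
    proof
      fix p assume "p \<in> ?A \<times> ?B"
      then obtain \<nu> \<tau> where p: "p = (\<nu>, \<tau>)" and \<nu>: "\<nu> \<in> mspace C01" "mdist C01 \<nu> \<mu> < \<delta>"
        and \<tau>: "0 < \<tau>" "\<bar>\<tau> - \<sigma>\<bar> < \<delta>" by auto
      have "mdist C01 \<mu> \<nu> < \<delta>" using \<nu> by (simp add: mdist_commute)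
      from \<delta>(2)[OF \<nu>(1) this \<tau>]
      have "L1_norm (\<lambda>y. f_mix \<nu> \<tau> y - f_mix \<mu> \<sigma> y) < \<epsilon> / 2" .
      moreover have "L1_norm (\<lambda>y. f_mix \<nu> \<tau> y - f0 y)
          \<le> L1_norm (\<lambda>y. f_mix \<nu> \<tau> y - f_mix \<mu> \<sigma> y) + L1_norm (\<lambda>y. f_mix \<mu> \<sigma> y - f0 y)"
        by (intro L1_norm_triangle f_mix_in_densities mspace_C01_unit_measurable \<mu> \<nu> \<tau> m f0)
      ultimately show "p \<in> ?W \<epsilon>"
        using near \<nu> \<tau> by (simp add: p)
    qed
    moreover have "?W \<epsilon> \<in> sets (\<Pi>\<mu> \<Otimes>\<^sub>M \<Pi>\<sigma>)"
    proof -
      have "?W \<epsilon> = {(\<mu>, \<sigma>). \<mu> \<in> mspace C01 \<and> 0 < \<sigma> \<and> f_mix \<mu> \<sigma> \<in> L1_ball f0 \<epsilon>}"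
        by (auto simp: L1_ball_def intro!: f_mix_in_densities mspace_C01_unit_measurable)
      then show ?thesis
        using f_mix_preimage_sets[OF M N L1_ball_openin[OF f0]] by simp
    qed
    ultimately have "emeasure (\<Pi>\<mu> \<Otimes>\<^sub>M \<Pi>\<sigma>) (?A \<times> ?B) \<le> emeasure (\<Pi>\<mu> \<Otimes>\<^sub>M \<Pi>\<sigma>) (?W \<epsilon>)"
      by (rule emeasure_mono)
    moreover have "emeasure (\<Pi>\<mu> \<Otimes>\<^sub>M \<Pi>\<sigma>) (?A \<times> ?B) = emeasure \<Pi>\<mu> ?A * emeasure \<Pi>\<sigma> ?B"
    proof (rule S.emeasure_pair_measure_Times)
      show "?A \<in> sets \<Pi>\<mu>"
        using mball_C01_sets[OF \<mu>, of \<delta>] by (simp add: M mdist_commute)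
      show "?B \<in> sets \<Pi>\<sigma>"
        unfolding N by (subst sets_restrict_space_iff) auto
    qed
    moreover have "0 < emeasure \<Pi>\<mu> ?A * emeasure \<Pi>\<sigma> ?B"
      unfolding ennreal_zero_less_mult_iff
    proof
      show "0 < emeasure \<Pi>\<mu> ?A" by (rule assms(3)[OF \<mu> \<delta>(1)])
      show "0 < emeasure \<Pi>\<sigma> ?B"
      proof (rule assms(6))
        show "openin (top_of_set {0..}) ?B"
          by (rule open_subset) auto
        show "?B \<noteq> {}" using \<delta>(1) m(2) by (auto intro!: exI[of _ \<sigma>])
      qed
    qed
    ultimately show ?thesis by simp
  qed
  then show ?thesis
    using f0 by (simp add: L1_support_def induced_prior_L1_ball[OF M N f0])
qed

end
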